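(* Let $(V,K)$ be a complete graph and $\mathcal{M}$ a 1-extendable $d$-dimensional abstract rigidity matroid on $K$. Then every $d(d+1)$-connected subgraph $(U,E)$ of $(V,K)$ is $\mathcal{M}$-rigid.
   Context: For $F\subseteq K$, $V(F)$ is the set of endpoints of edges in $F$, and $K(W)$ is the edge set of the complete graph on $W$. A matroid $\mathcal{M}$ on $K$ with closure operator $\langle\cdot\rangle$ is a $d$-dimensional abstract rigidity matroid if: (1) for $E,F\subseteq K$ with $|V(E)\cap V(F)|<d$, $\langle E\cup F\rangle\subseteq K(V(E))\cup K(V(F))$; and (2) if $E,F\subseteq K$ are $\mathcal{M}$-rigid and $|V(E)\cap V(F)|\ge d$, then $E\cup F$ is $\mathcal{M}$-rigid. Here $E\subseteq K$ is $\mathcal{M}$-rigid if $\langle E\rangle=K(V(E))$, and a subgraph $(U,E)$ is $\mathcal{M}$-rigid if $\langle E\rangle=K(U)$. A subgraph is $\mathcal{M}$-independent if its edge set is independent in $\mathcal{M}$. The $d$-dimensional 1-extension operation on an edge $v_1v_2$ and vertices $v_3,\dots,v_{d+1}$ deletes $v_1v_2$ and adds a new vertex $v$ with edges $vv_1,\dots,vv_{d+1}$. $\mathcal{M}$ is 1-extendable if the 1-extension operation (performed within $(V,K)$) preserves $\mathcal{M}$-independence. *)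

theory Defs
  imports Main "HOL-Library.Ramsey"
begin

text \<open>
  A graph is a pair of a vertex set and an edge set, edges being two-element sets of vertices.
  The edge set \<open>K(W)\<close> of the complete graph on \<open>W\<close> is \<open>[W]\<^bsup>2\<^esup>\<close>, and the set \<open>V(F)\<close> of endpoints
  of the edges in \<open>F\<close> is \<open>\<Union>F\<close>.
\<close>

definition subgraph :: "'a set \<times> 'a set set \<Rightarrow> 'a set \<times> 'a set set \<Rightarrow> bool" where
  "subgraph H G \<longleftrightarrow> fst H \<subseteq> fst G \<and> snd H \<subseteq> snd G \<and> snd H \<subseteq> [fst H]\<^bsup>2\<^esup>"

definition connected_graph :: "'a set \<times> 'a set set \<Rightarrow> bool" where
  "connected_graph G \<longleftrightarrow>
     fst G \<noteq> {} \<and> (\<forall>u\<in>fst G. \<forall>v\<in>fst G. (u, v) \<in> {(x, y). {x, y} \<in> snd G}\<^sup>*)"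

definition delete_vertices :: "'a set \<times> 'a set set \<Rightarrow> 'a set \<Rightarrow> 'a set \<times> 'a set set" where
  "delete_vertices G X = (fst G - X, {e \<in> snd G. e \<inter> X = {}})"

definition k_connected :: "nat \<Rightarrow> 'a set \<times> 'a set set \<Rightarrow> bool" where
  "k_connected k G \<longleftrightarrow>
     card (fst G) > k \<and>
     (\<forall>X \<subseteq> fst G. card X < k \<longrightarrow> connected_graph (delete_vertices G X))"

locale matroid =
  fixes carrier :: "'e set" and \<I> :: "'e set set"
  assumes finite_carrier: "finite carrier"
    and indep_subset_carrier: "X \<in> \<I> \<Longrightarrow> X \<subseteq> carrier"
    and empty_indep: "{} \<in> \<I>"
    and indep_subset: "X \<in> \<I> \<Longrightarrow> Y \<subseteq> X \<Longrightarrow> Y \<in> \<I>"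
    and augment: "X \<in> \<I> \<Longrightarrow> Y \<in> \<I> \<Longrightarrow> card X < card Y \<Longrightarrow> \<exists>y\<in>Y - X. insert y X \<in> \<I>"

definition matroid_rank :: "'e set set \<Rightarrow> 'e set \<Rightarrow> nat" where
  "matroid_rank \<I> X = Max (card ` {Y \<in> \<I>. Y \<subseteq> X})"

definition matroid_closure :: "'e set \<Rightarrow> 'e set set \<Rightarrow> 'e set \<Rightarrow> 'e set" where
  "matroid_closure carrier \<I> X =
     {e \<in> carrier. matroid_rank \<I> (insert e X) = matroid_rank \<I> X}"

text \<open>From here on, \<open>\<I>\<close> is the family of independent sets of a matroid on \<open>[V]\<^bsup>2\<^esup>\<close>.\<close>

definition rigid_edge_set :: "'a set \<Rightarrow> 'a set set set \<Rightarrow> 'a set set \<Rightarrow> bool" where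
  "rigid_edge_set V \<I> E \<longleftrightarrow> matroid_closure ([V]\<^bsup>2\<^esup>) \<I> E = [\<Union>E]\<^bsup>2\<^esup>"

definition rigid_graph :: "'a set \<Rightarrow> 'a set set set \<Rightarrow> 'a set \<times> 'a set set \<Rightarrow> bool" where
  "rigid_graph V \<I> G \<longleftrightarrow> matroid_closure ([V]\<^bsup>2\<^esup>) \<I> (snd G) = [fst G]\<^bsup>2\<^esup>"

locale abstract_rigidity_matroid = matroid "[V]\<^bsup>2\<^esup>" \<I>
  for d :: nat and V :: "'a set" and \<I> :: "'a set set set" +
  assumes closure_Un_subset:
    "E \<subseteq> [V]\<^bsup>2\<^esup> \<Longrightarrow> F \<subseteq> [V]\<^bsup>2\<^esup> \<Longrightarrow> card (\<Union>E \<inter> \<Union>F) < d \<Longrightarrow>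
     matroid_closure ([V]\<^bsup>2\<^esup>) \<I> (E \<union> F) \<subseteq> [\<Union>E]\<^bsup>2\<^esup> \<union> [\<Union>F]\<^bsup>2\<^esup>"
    and rigid_Un:
    "E \<subseteq> [V]\<^bsup>2\<^esup> \<Longrightarrow> F \<subseteq> [V]\<^bsup>2\<^esup> \<Longrightarrow> rigid_edge_set V \<I> E \<Longrightarrow> rigid_edge_set V \<I> F \<Longrightarrow>
     card (\<Union>E \<inter> \<Union>F) \<ge> d \<Longrightarrow> rigid_edge_set V \<I> (E \<union> F)"

text \<open>
  The vertices \<open>v\<^sub>1, \<dots>, v\<^sub>d\<^sub>+\<^sub>1\<close> are given by a function on \<open>{1..d + 1}\<close>; the dimension \<open>d\<close> is
  meant to be positive, so that \<open>v\<^sub>1\<close> and \<open>v\<^sub>2\<close> are among them.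
\<close>

definition one_extension ::
  "nat \<Rightarrow> 'a set \<times> 'a set set \<Rightarrow> 'a set \<times> 'a set set \<Rightarrow> bool" where
  "one_extension d G G' \<longleftrightarrow>
     (\<exists>v w. inj_on w {1..d + 1} \<and> w ` {1..d + 1} \<subseteq> fst G \<and>
        {w 1, w 2} \<in> snd G \<and> v \<notin> fst G \<and>
        G' = (insert v (fst G), (snd G - {{w 1, w 2}}) \<union> {{v, w i} | i. i \<in> {1..d + 1}}))"

definition one_extendable :: "nat \<Rightarrow> 'a set \<Rightarrow> 'a set set set \<Rightarrow> bool" where
  "one_extendable d V \<I> \<longleftrightarrow>
     (\<forall>G G'. subgraph G (V, [V]\<^bsup>2\<^esup>) \<longrightarrow> subgraph G' (V, [V]\<^bsup>2\<^esup>) \<longrightarrow>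
        one_extension d G G' \<longrightarrow> snd G \<in> \<I> \<longrightarrow> snd G' \<in> \<I>)"

end

theory Submission
  imports Defs Complex_Main
begin

text \<open>
  Replacing \<open>E\<close> by its closure, we may assume that \<open>E\<close> is closed and have to show that it is
  complete. A vertex whose neighbourhood is a clique can be deleted, so suppose there is none.
  Add the vertices of \<open>U\<close> in a uniformly random order, keeping an independent set of edges. If
  \<open>X\<close> is the set of earlier neighbours of the new vertex \<open>v\<close>, then \<open>min d (card X)\<close> edges at
  \<open>v\<close> can be added by a 0-extension, and \<open>d + 1\<close> edges by a 1-extension if \<open>card X > d\<close> and
  \<open>X\<close> contains a non-adjacent pair: since \<open>E\<close> is closed, this pair is not spanned by the edges
  kept so far. Cliques of \<open>E\<close> with \<open>d\<close> common vertices have a clique as union, which bounds the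
  number of cliques in the neighbourhood of \<open>v\<close>; together with \<open>v\<close> having at least
  \<open>d * (d + 1)\<close> neighbours this makes the expected number of edges added at \<open>v\<close> at least \<open>d\<close>.
  Hence some order gives at least \<open>d * card U\<close> independent edges, more than the rank of the
  complete graph on \<open>U\<close>.
\<close>

section \<open>Rank and closure in a matroid\<close>

context matroid
begin

abbreviation rank :: "'e set \<Rightarrow> nat" where
  "rank \<equiv> matroid_rank \<I>"

abbreviation cl :: "'e set \<Rightarrow> 'e set" where
  "cl \<equiv> matroid_closure carrier \<I>"

lemma finite_indep: "X \<in> \<I> \<Longrightarrow> finite X"
  using finite_carrier finite_subset indep_subset_carrier by metis

lemma finite_indep_family: "finite {Y \<in> \<I>. Y \<subseteq> X}"
proof -
  have "{Y \<in> \<I>. Y \<subseteq> X} \<subseteq> Pow carrier"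
    using indep_subset_carrier by blast
  then show ?thesis
    using finite_carrier finite_subset by blast
qed

lemma card_le_rank: "Y \<in> \<I> \<Longrightarrow> Y \<subseteq> X \<Longrightarrow> card Y \<le> rank X"
  unfolding matroid_rank_def by (rule Max_ge) (auto simp: finite_indep_family)

lemma obtain_basis:
  obtains B where "B \<in> \<I>" "B \<subseteq> X" "card B = rank X"
proof -
  have "rank X \<in> card ` {Y \<in> \<I>. Y \<subseteq> X}"
    unfolding matroid_rank_def
    by (rule Max_in) (use finite_indep_family empty_indep in auto)
  then show ?thesis
    using that by auto
qed

lemma rank_mono: "X \<subseteq> Y \<Longrightarrow> rank X \<le> rank Y"
  by (metis obtain_basis card_le_rank order_trans)

lemma rank_le_card: "finite X \<Longrightarrow> rank X \<le> card X"
  by (metis obtain_basis card_mono)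

lemma rank_indep: "X \<in> \<I> \<Longrightarrow> rank X = card X"
  by (simp add: card_le_rank rank_le_card finite_indep order_antisym)

lemma rank_Un_le:
  assumes "finite B"
  shows "rank (A \<union> B) \<le> rank A + card B"
proof -
  obtain Y where Y: "Y \<in> \<I>" "Y \<subseteq> A \<union> B" "card Y = rank (A \<union> B)"
    by (rule obtain_basis)
  have "card Y \<le> card (Y \<inter> A) + card (Y \<inter> B)"
    by (metis Y(2) Int_Un_distrib card_Un_le inf.absorb_iff1)
  also have "\<dots> \<le> rank A + card B"
    using assms Y(1) indep_subset by (intro add_mono card_le_rank card_mono) auto
  finally show ?thesis
    using Y(3) by simp
qed

lemma insert_indep:
  assumes "X \<in> \<I>" "e \<in> carrier" "e \<notin> cl X"
  shows "insert e X \<in> \<I>"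
proof -
  have "rank (insert e X) > card X"
    using assms rank_mono[OF subset_insertI, of X e] rank_indep[of X]
    by (auto simp: matroid_closure_def)
  moreover obtain Y where Y: "Y \<in> \<I>" "Y \<subseteq> insert e X" "card Y = rank (insert e X)"
    by (rule obtain_basis)
  moreover have "card (insert e X) \<le> Suc (card X)"
    by (simp add: card_insert_le_m1 finite_indep[OF assms(1)] card_insert_if)
  ultimately have "Y = insert e X"
    by (intro card_seteq) (auto simp: finite_indep[OF assms(1)])
  then show ?thesis
    using Y(1) by simp
qed

lemma extend_to_basis:
  assumes "X \<in> \<I>" "X \<subseteq> S"
  obtains B where "B \<in> \<I>" "X \<subseteq> B" "B \<subseteq> S" "card B = rank S"
  using assms
proof (induction "rank S - card X" arbitrary: X thesis)
  case 0
  then show ?case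
    using card_le_rank[of X S] by (metis order_antisym order_refl diff_is_0_eq)
next
  case (Suc n)
  obtain Y where Y: "Y \<in> \<I>" "Y \<subseteq> S" "card Y = rank S"
    by (rule obtain_basis)
  obtain y where y: "y \<in> Y - X" "insert y X \<in> \<I>"
    using augment[OF Suc.prems(2) Y(1)] Suc.hyps(2) Y(3) by fastforce
  have "card (insert y X) = Suc (card X)"
    using y(1) finite_indep[OF Suc.prems(2)] by simp
  then have "n = rank S - card (insert y X)"
    using Suc.hyps(2) by simp
  moreover have "insert y X \<subseteq> S"
    using y Y(2) Suc.prems(3) by auto
  ultimately show ?case
    using Suc.hyps(1)[of "insert y X"] Suc.prems(1) y(2) by auto
qed

lemma subset_cl: "X \<subseteq> carrier \<Longrightarrow> X \<subseteq> cl X"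
  by (auto simp: matroid_closure_def insert_absorb)

text \<open>If \<open>e\<close> raised the rank of \<open>Y\<close>, a basis \<open>B\<close> of
  \<open>X\<close>, extended through a basis of \<open>Y\<close> to one of
  \<open>insert e Y\<close>, would pick up \<open>e\<close>. Then \<open>insert e B\<close> is
  independent, so \<open>e\<close> raises the rank of \<open>X\<close> as well.\<close>

lemma cl_mono:
  assumes "X \<subseteq> Y"
  shows "cl X \<subseteq> cl Y"
proof
  fix e assume e: "e \<in> cl X"
  obtain B where B: "B \<in> \<I>" "B \<subseteq> X" "card B = rank X"
    by (rule obtain_basis)
  obtain B' where B': "B' \<in> \<I>" "B \<subseteq> B'" "B' \<subseteq> Y" "card B' = rank Y"
    using extend_to_basis[of B Y] B assms by blast
  show "e \<in> cl Y"
  proof (rule ccontr)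
    assume "e \<notin> cl Y"
    then have less: "rank Y < rank (insert e Y)"
      using e rank_mono[OF subset_insertI, of Y e] by (auto simp: matroid_closure_def)
    obtain C where C: "C \<in> \<I>" "B' \<subseteq> C" "C \<subseteq> insert e Y" "card C = rank (insert e Y)"
      using extend_to_basis[of B' "insert e Y"] B' by blast
    have "e \<in> C"
      using C less card_le_rank[of C Y] by auto
    then have ind: "insert e B \<in> \<I>"
      using C(1,2) B'(2) indep_subset by blast
    have "e \<notin> Y"
      using less by (auto simp: insert_absorb)
    then have "card (insert e B) = Suc (rank X)"
      using B assms finite_indep[OF B(1)] by (subst card_insert_disjoint) auto
    moreover have "card (insert e B) \<le> rank (insert e X)"
      using ind B(2) by (intro card_le_rank) auto
    ultimately show False
      using e by (simp add: matroid_closure_def)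
  qed
qed

text \<open>Otherwise a basis of \<open>X\<close> could be augmented by some \<open>y\<close> of
  \<open>cl X\<close>, and this \<open>y\<close> would raise the rank of \<open>X\<close>.\<close>

lemma rank_cl: "X \<subseteq> carrier \<Longrightarrow> rank (cl X) = rank X"
proof (rule antisym)
  obtain B where B: "B \<in> \<I>" "B \<subseteq> X" "card B = rank X"
    by (rule obtain_basis)
  obtain Y where Y: "Y \<in> \<I>" "Y \<subseteq> cl X" "card Y = rank (cl X)"
    by (rule obtain_basis)
  show "rank (cl X) \<le> rank X"
  proof (rule ccontr)
    assume "\<not> rank (cl X) \<le> rank X"
    then obtain y where y: "y \<in> Y - B" "insert y B \<in> \<I>"
      using augment[OF B(1) Y(1)] B(3) Y(3) by auto
    have "card (insert y B) \<le> rank (insert y X)"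
      using y B(2) by (intro card_le_rank) auto
    moreover have "rank (insert y X) = rank X"
      using y(1) Y(2) by (auto simp: matroid_closure_def)
    ultimately show False
      using y(1) B finite_indep by auto
  qed
qed (simp add: rank_mono subset_cl)

lemma cl_idem:
  assumes "X \<subseteq> carrier"
  shows "cl (cl X) = cl X"
proof
  show "cl (cl X) \<subseteq> cl X"
  proof
    fix e assume e: "e \<in> cl (cl X)"
    have "rank (insert e X) \<le> rank (insert e (cl X))"
      using subset_cl[OF assms] by (intro rank_mono) auto
    also have "\<dots> = rank X"
      using e rank_cl[OF assms] by (simp add: matroid_closure_def)
    finally show "e \<in> cl X"
      using e rank_mono[OF subset_insertI, of X e] by (auto simp: matroid_closure_def)
  qed
  show "cl X \<subseteq> cl (cl X)"
    by (rule cl_mono[OF subset_cl[OF assms]])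
qed

end

section \<open>Averaging over initial segments of a random ordering\<close>

text \<open>
  When \<open>v\<close> is inserted at a uniformly random place of a random ordering of \<open>Y\<close>, the set of
  elements preceding \<open>v\<close> equals \<open>X\<close> with probability
  \<open>1 / ((card Y + 1) * (card Y choose card X))\<close>; \<open>segment_mean g Y\<close> is the expectation of \<open>g\<close>
  on this set.
\<close>

definition segment_mean :: "('a set \<Rightarrow> real) \<Rightarrow> 'a set \<Rightarrow> real" where
  "segment_mean g Y = (\<Sum>X\<in>Pow Y. g X / ((real (card Y) + 1) * real (card Y choose card X)))"

text \<open>Condition on the last element of a random order of \<open>Y\<close> and
  \<open>v\<close>: if it is \<open>v\<close>, all of \<open>Y\<close> precedes \<open>v\<close>; if
  it is \<open>u\<close>, what remains is a random order of \<open>Y - {u}\<close> and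
  \<open>v\<close>.\<close>

lemma segment_mean_rec:
  assumes "finite Y"
  shows "(real (card Y) + 1) * segment_mean g Y = g Y + (\<Sum>u\<in>Y. segment_mean g (Y - {u}))"
proof -
  define D where "D = card Y"
  \<comment> \<open>A proper subset \<open>X\<close> occurs in \<open>Pow (Y - {u})\<close> for
    \<open>D - card X\<close> choices of \<open>u\<close>; binomial absorption computes their joint
    weight.\<close>
  have coeff: "(real D - real (card X)) * (g X / (real D * real ((D - 1) choose card X)))
      = g X / real (D choose card X)" if X: "X \<in> Pow Y - {Y}" for X
  proof -
    have "card X < D"
      unfolding D_def using X assms by (intro psubset_card_mono) auto
    then obtain D' where D': "D = Suc D'" "card X \<le> D'"
      by (cases D) auto
    have "Suc D' * (D' choose card X) = (Suc D' choose card X) * (Suc D' - card X)"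
      using D'(2) binomial_absorb_comp[of "Suc D'" "card X"] by (simp add: mult.commute)
    then have "real (Suc D') * real (D' choose card X)
        = real (Suc D' choose card X) * (real (Suc D') - real (card X))"
      by (metis D'(2) le_SucI of_nat_diff of_nat_mult)
    moreover have "real (D' choose card X) > 0" "real (Suc D' choose card X) > 0"
        "real (Suc D') - real (card X) > 0"
      using D'(2) by (auto simp del: binomial_Suc_n of_nat_Suc)
    ultimately show ?thesis
      unfolding D' by (simp add: divide_simps del: of_nat_Suc)
  qed
  have "(\<Sum>u\<in>Y. segment_mean g (Y - {u}))
      = (\<Sum>u\<in>Y. \<Sum>X\<in>Pow (Y - {u}). g X / (real D * real ((D - 1) choose card X)))"
  proof (rule sum.cong[OF refl])
    fix u assume "u \<in> Y"
    then have "0 < D" "card (Y - {u}) = D - 1"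
      using assms unfolding D_def by (auto simp: card_gt_0_iff)
    moreover from this have "real (D - 1) + 1 = real D"
      by simp
    ultimately show "segment_mean g (Y - {u})
        = (\<Sum>X\<in>Pow (Y - {u}). g X / (real D * real ((D - 1) choose card X)))"
      unfolding segment_mean_def by simp
  qed
  also have "\<dots> = (\<Sum>u\<in>Y. \<Sum>X | X \<in> Pow Y - {Y} \<and> u \<notin> X.
      g X / (real D * real ((D - 1) choose card X)))"
    by (intro sum.cong refl) auto
  also have "\<dots> = (\<Sum>X\<in>Pow Y - {Y}. \<Sum>u | u \<in> Y \<and> u \<notin> X.
      g X / (real D * real ((D - 1) choose card X)))"
    using assms by (intro sum.swap_restrict) auto
  also have "\<dots> = (\<Sum>X\<in>Pow Y - {Y}. g X / real (D choose card X))"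
  proof (rule sum.cong[OF refl])
    fix X assume X: "X \<in> Pow Y - {Y}"
    have "{u. u \<in> Y \<and> u \<notin> X} = Y - X"
      by auto
    moreover have "real (card (Y - X)) = real D - real (card X)"
      using X assms unfolding D_def
      by (auto simp: card_Diff_subset finite_subset card_mono)
    ultimately show "(\<Sum>u | u \<in> Y \<and> u \<notin> X. g X / (real D * real ((D - 1) choose card X)))
        = g X / real (D choose card X)"
      using coeff[OF X] by simp
  qed
  \<comment> \<open>The set \<open>Y\<close> itself is missing from the swapped sum;
    \<open>g Y\<close> supplies it, as \<open>D choose D\<close> is 1.\<close>
  also have "g Y + \<dots> = (\<Sum>X\<in>Pow Y. g X / real (D choose card X))"
    using assms by (subst (2) sum.remove[of _ Y]) (auto simp: D_def)
  also have "\<dots> = (real (card Y) + 1) * segment_mean g Y"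
    unfolding segment_mean_def sum_distrib_left D_def
    by (intro sum.cong refl) (simp add: add_nonneg_eq_0_iff)
  finally show ?thesis
    by simp
qed

text \<open>
  The sum is the expected total gain when \<open>U\<close> is built up in random order.
\<close>

lemma sum_segment_mean_le:
  fixes r :: "'a set \<Rightarrow> real" and g :: "'a \<Rightarrow> 'a set \<Rightarrow> real" and N :: "'a \<Rightarrow> 'a set"
  assumes "finite U"
    and irrefl: "\<And>v. v \<notin> N v"
    and nonneg: "\<And>W. 0 \<le> r W"
    and gain: "\<And>v W. W \<subseteq> U \<Longrightarrow> v \<in> W \<Longrightarrow> r (W - {v}) + g v (N v \<inter> W) \<le> r W"
  shows "(\<Sum>v\<in>U. segment_mean (g v) (N v \<inter> U)) \<le> r U"
proof -
  have "(\<Sum>v\<in>W. segment_mean (g v) (N v \<inter> W)) \<le> r W" if "W \<subseteq> U" for W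
    using that
  proof (induction "card W" arbitrary: W)
    case 0
    then have "W = {}"
      using assms(1) finite_subset by fastforce
    then show ?case
      using nonneg by simp
  next
    case (Suc n)
    have fin: "finite W"
      using Suc.prems assms(1) finite_subset by blast
    let ?p = "\<lambda>u Y. segment_mean (g u) (N u \<inter> Y)"
    \<comment> \<open>Removing a non-neighbour \<open>v\<close> of \<open>u\<close> leaves the mean
      at \<open>u\<close> unchanged, and there are \<open>card W - 1 - card ?Y\<close> of these.
      With the factor \<open>card ?Y + 1\<close> from \<open>segment_mean_rec\<close> they add up to
      \<open>card W\<close>.\<close>
    have rec: "g u (N u \<inter> W) + (\<Sum>v\<in>W - {u}. ?p u (W - {v})) = real (card W) * ?p u W"
      if u: "u \<in> W" for u
    proof -
      let ?Y = "N u \<inter> W"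
      have "W - {u} = ?Y \<union> (W - {u} - ?Y)"
        using irrefl by auto
      then have "(\<Sum>v\<in>W - {u}. ?p u (W - {v}))
          = (\<Sum>v\<in>?Y. ?p u (W - {v})) + (\<Sum>v\<in>W - {u} - ?Y. ?p u (W - {v}))"
        using fin by (subst sum.union_disjoint[symmetric]) auto
      moreover have "(\<Sum>v\<in>?Y. ?p u (W - {v})) = (\<Sum>v\<in>?Y. segment_mean (g u) (?Y - {v}))"
        by (intro sum.cong refl arg_cong[where f = "segment_mean (g u)"]) auto
      moreover have "(\<Sum>v\<in>W - {u} - ?Y. ?p u (W - {v})) = (\<Sum>v\<in>W - {u} - ?Y. ?p u W)"
        by (intro sum.cong refl arg_cong[where f = "segment_mean (g u)"]) auto
      moreover have "real (card (W - {u} - ?Y)) = real (card W) - 1 - real (card ?Y)"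
      proof -
        have "card W = Suc (card (W - {u}))"
          using card_Suc_Diff1[OF fin u] by simp
        moreover have "?Y \<subseteq> W - {u}"
          using irrefl by auto
        ultimately show ?thesis
          using fin by (simp add: card_Diff_subset card_mono)
      qed
      ultimately show ?thesis
        using segment_mean_rec[of ?Y "g u"] fin by (simp add: algebra_simps)
    qed
    \<comment> \<open>Averaging over the last vertex \<open>v\<close> of the order: exchanging the
      sums isolates the total for \<open>W - {v}\<close>, to which the induction hypothesis
      applies.\<close>
    have "real (card W) * (\<Sum>u\<in>W. ?p u W)
        = (\<Sum>u\<in>W. g u (N u \<inter> W)) + (\<Sum>u\<in>W. \<Sum>v\<in>W - {u}. ?p u (W - {v}))"
      using rec by (simp add: sum_distrib_left flip: sum.distrib)
    also have "(\<Sum>u\<in>W. \<Sum>v\<in>W - {u}. ?p u (W - {v}))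
        = (\<Sum>u\<in>W. \<Sum>v | v \<in> W \<and> u \<noteq> v. ?p u (W - {v}))"
      by (intro sum.cong refl) auto
    also have "\<dots> = (\<Sum>v\<in>W. \<Sum>u | u \<in> W \<and> u \<noteq> v. ?p u (W - {v}))"
      using fin by (intro sum.swap_restrict)
    also have "\<dots> = (\<Sum>v\<in>W. \<Sum>u\<in>W - {v}. ?p u (W - {v}))"
      by (intro sum.cong refl) auto
    also have "\<dots> \<le> (\<Sum>v\<in>W. r (W - {v}))"
    proof (rule sum_mono)
      fix v assume "v \<in> W"
      then show "(\<Sum>u\<in>W - {v}. ?p u (W - {v})) \<le> r (W - {v})"
        using Suc.hyps(2) Suc.prems fin by (intro Suc.hyps(1)) auto
    qed
    also have "(\<Sum>v\<in>W. g v (N v \<inter> W)) + (\<Sum>v\<in>W. r (W - {v})) \<le> (\<Sum>v\<in>W. r W)"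
      unfolding sum.distrib[symmetric]
      by (intro sum_mono) (use gain[OF Suc.prems] in \<open>simp add: add.commute\<close>)
    finally have "real (card W) * (\<Sum>u\<in>W. ?p u W) \<le> real (card W) * r W"
      by simp
    moreover have "real (card W) > 0"
      using Suc.hyps(2) by simp
    ultimately show ?case
      by simp
  qed
  then show ?thesis
    by simp
qed

section \<open>Counting the cliques of a neighbourhood\<close>

text \<open>
  The bound is attained when \<open>Q\<close> holds for all subsets of \<open>N\<close> minus one point.
\<close>

lemma card_union_closed_family_le:
  fixes Q :: "'a set \<Rightarrow> bool"
  assumes "finite N" "\<not> Q N" "s < m"
    and "\<And>A B. A \<subseteq> N \<Longrightarrow> B \<subseteq> N \<Longrightarrow> Q A \<Longrightarrow> Q B \<Longrightarrow> s \<le> card (A \<inter> B) \<Longrightarrow> Q (A \<union> B)"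
  shows "card {A. A \<subseteq> N \<and> card A = m \<and> Q A} \<le> (card N - 1) choose m"
  using assms
proof (induction "card N" arbitrary: N)
  case 0
  then have "{A. A \<subseteq> N \<and> card A = m \<and> Q A} = {}"
    by auto
  then show ?case
    by (metis card.empty zero_le)
next
  case (Suc n)
  let ?F = "\<lambda>N. {A. A \<subseteq> N \<and> card A = m \<and> Q A}"
  have finF: "finite (?F M)" if "M \<subseteq> N" for M
    by (rule finite_subset[of _ "Pow N"]) (use that Suc.prems(1) in auto)
  show ?case
  proof (cases "card N \<le> m")
    case True
    have "?F N = {}"
    proof (rule ccontr)
      assume "?F N \<noteq> {}"
      then obtain A where A: "A \<subseteq> N" "card A = m" "Q A"
        by auto
      then have "A = N"
        using Suc.prems(1) True by (intro card_seteq) auto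
      then show False
        using A Suc.prems(2) by simp
    qed
    then show ?thesis
      by (metis card.empty zero_le)
  next
    case False
    show ?thesis
    proof (cases "\<exists>x\<in>N. Q (N - {x})")
      case True
      then obtain x where x: "x \<in> N" "Q (N - {x})"
        by blast
      \<comment> \<open>If \<open>A\<close> contained \<open>x\<close>, it would meet
        \<open>N - {x}\<close> in \<open>m - 1\<close> points, at least \<open>s\<close>, and the
        union of both sets, which is \<open>N\<close>, would satisfy \<open>Q\<close>.\<close>
      have "?F N \<subseteq> {A. A \<subseteq> N - {x} \<and> card A = m}"
      proof (clarify; rule conjI)
        fix A assume A: "A \<subseteq> N" "Q A" "m = card A"
        show "A \<subseteq> N - {x}"
        proof (rule ccontr)
          assume "\<not> A \<subseteq> N - {x}"
          then have xA: "x \<in> A"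
            using A(1) by auto
          have "A \<inter> (N - {x}) = A - {x}"
            using A(1) by auto
          then have "s \<le> card (A \<inter> (N - {x}))"
            using xA A Suc.prems(1,3) by (simp add: finite_subset)
          then have "Q (A \<union> (N - {x}))"
            using A x by (intro Suc.prems(4)) auto
          moreover have "A \<union> (N - {x}) = N"
            using A(1) xA by auto
          ultimately show False
            using Suc.prems(2) by simp
        qed
      qed auto
      then have "card (?F N) \<le> card {A. A \<subseteq> N - {x} \<and> card A = m}"
        using Suc.prems(1) by (intro card_mono) auto
      also have "\<dots> = (card N - 1) choose m"
        using n_subsets[of "N - {x}" m] Suc.prems(1) x(1) by simp
      finally show ?thesis .
    next
      case nQ: False
      have IH: "card (?F (N - {x})) \<le> (n - 1) choose m" if "x \<in> N" for x
      proof -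
        have "card (N - {x}) = n"
          using that Suc.hyps(2) Suc.prems(1) by simp
        moreover have "Q (A \<union> B)"
          if "A \<subseteq> N - {x}" "B \<subseteq> N - {x}" "Q A" "Q B" "s \<le> card (A \<inter> B)" for A B
          using that by (intro Suc.prems(4)) auto
        ultimately show ?thesis
          using Suc.hyps(1)[of "N - {x}"] Suc.prems(1,3) nQ that by auto
      qed
      \<comment> \<open>Pairs of a set \<open>A\<close> in the family and a point outside
        \<open>A\<close> are counted in two ways; the sets avoiding a given point are bounded by
        induction.\<close>
      have "(card N - m) * card (?F N) = (\<Sum>A\<in>?F N. \<Sum>x | x \<in> N \<and> x \<notin> A. 1)"
      proof -
        have "(\<Sum>x | x \<in> N \<and> x \<notin> A. 1) = card N - m" if "A \<in> ?F N" for A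
        proof -
          have "{x. x \<in> N \<and> x \<notin> A} = N - A"
            by auto
          then show ?thesis
            using that Suc.prems(1) by (auto simp: card_Diff_subset finite_subset)
        qed
        then show ?thesis
          by simp
      qed
      also have "\<dots> = (\<Sum>x\<in>N. \<Sum>A | A \<in> ?F N \<and> x \<notin> A. 1)"
        using Suc.prems(1) finF[of N] by (intro sum.swap_restrict) auto
      also have "\<dots> = (\<Sum>x\<in>N. card (?F (N - {x})))"
      proof (rule sum.cong[OF refl])
        fix x assume "x \<in> N"
        have "{A \<in> ?F N. x \<notin> A} = ?F (N - {x})"
          by auto
        then show "(\<Sum>A | A \<in> ?F N \<and> x \<notin> A. 1) = card (?F (N - {x}))"
          by simp
      qed
      also have "\<dots> \<le> (\<Sum>x\<in>N. (n - 1) choose m)"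
        by (intro sum_mono IH)
      finally have le: "(Suc n - m) * card (?F N) \<le> Suc n * ((n - 1) choose m)"
        using Suc.hyps(2) by simp
      have mn: "m \<le> n" "0 < n"
        using False Suc.hyps(2) Suc.prems(3) by auto
      \<comment> \<open>An extra factor \<open>n\<close> makes absorption applicable to
        \<open>(n - 1) choose m\<close>; in the inequality that follows, the two sides differ by
        exactly \<open>m\<close>.\<close>
      have eq: "n * ((n - 1) choose m) = (n - m) * (n choose m)"
        using binomial_absorb_comp[of n m] by simp
      have "Suc n * (n - m) \<le> n * (Suc n - m)"
        using mn by (simp add: algebra_simps diff_mult_distrib2 Suc_diff_le)
      have "n * ((Suc n - m) * card (?F N)) \<le> Suc n * (n * ((n - 1) choose m))"
        using mult_le_mono2[OF le, of n] by (simp only: mult.left_commute)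
      also have "\<dots> = (Suc n * (n - m)) * (n choose m)"
        unfolding eq by (simp only: mult.assoc)
      also have "\<dots> \<le> (n * (Suc n - m)) * (n choose m)"
        by (rule mult_le_mono1) fact
      finally have "(n * (Suc n - m)) * card (?F N) \<le> (n * (Suc n - m)) * (n choose m)"
        by (simp only: mult.assoc)
      moreover have "0 < n * (Suc n - m)"
        using mn by simp
      ultimately have "card (?F N) \<le> n choose m"
        by (simp only: mult_le_cancel1)
      then show ?thesis
        using Suc.hyps(2) by (metis diff_Suc_1)
    qed
  qed
qed


text \<open>Closed form for the sum of the bounds \<open>h m\<close> in
  \<open>segment_mean_ge\<close>, where \<open>n\<close> is the size of the neighbourhood and
  \<open>c\<close> its reciprocal.\<close>

lemma sum_truncated_linear:
  fixes c :: real
  assumes "d \<le> n"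
  shows "(\<Sum>m\<le>n. if m \<le> d then real m else real d + real m * c)
    = real d * (real d + 1) / 2 + real d * (real n - real d)
      + c * (real n * (real n + 1) - real d * (real d + 1)) / 2"
  using assms
proof (induction n rule: nat_induct_at_least)
  case base
  have "(\<Sum>m\<le>d. if m \<le> d then real m else real d + real m * c) = (\<Sum>m\<le>d. real m)"
    by (intro sum.cong) auto
  also have "\<dots> = real d * (real d + 1) / 2"
    by (induction d) (auto simp: field_simps)
  finally show ?case
    by simp
next
  case (Suc n)
  then show ?case
    by (simp add: field_simps)
qed

text \<open>
  Compared with \<open>d\<close>, the terms with \<open>card X < d\<close> lose \<open>d * (d + 1) / 2\<close> in total, and the
  sets violating \<open>Q\<close> win this back as soon as \<open>card N\<close> is at least \<open>d * (d + 1)\<close>.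
\<close>

lemma segment_mean_ge:
  fixes Q :: "'a set \<Rightarrow> bool"
  assumes fin: "finite N" and nQ: "\<not> Q N" and d: "1 \<le> d" and large: "d * (d + 1) \<le> card N"
    and Un: "\<And>A B. A \<subseteq> N \<Longrightarrow> B \<subseteq> N \<Longrightarrow> Q A \<Longrightarrow> Q B \<Longrightarrow> d - 1 \<le> card (A \<inter> B) \<Longrightarrow> Q (A \<union> B)"
  shows "real d \<le>
    segment_mean (\<lambda>X. real (min d (card X) + (if d < card X \<and> \<not> Q X then 1 else 0))) N"
    (is "_ \<le> segment_mean ?g N")
proof -
  define D where "D = card N"
  have dD: "d \<le> D" "0 < D"
    using large d le_trans[of d "d * (d + 1)" D] unfolding D_def by auto
  \<comment> \<open>\<open>h m\<close> bounds from below the mean of \<open>?g\<close> over the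
    \<open>m\<close>-subsets: for \<open>m > d\<close>, at least the fraction \<open>m / D\<close>
    of them violates \<open>Q\<close>.\<close>
  define h where "h m = (if m \<le> d then real m else real d + real m * (1 / real D))" for m
  let ?S = "\<lambda>m. {X \<in> Pow N. card X = m}"
  have cardS: "card (?S m) = D choose m" for m
    using n_subsets[OF fin, of m] unfolding D_def by simp
  have finS: "finite (?S m)" for m
    using fin by simp
  have level: "h m * real (D choose m) \<le> (\<Sum>X\<in>?S m. ?g X)" if m: "m \<le> D" for m
  proof (cases "m \<le> d")
    case True
    have "(\<Sum>X\<in>?S m. ?g X) = (\<Sum>X\<in>?S m. real m)"
      using True by (intro sum.cong) auto
    then show ?thesis
      using True cardS by (simp add: h_def)
  next
    case False
    let ?C = "{X. X \<subseteq> N \<and> card X = m \<and> Q X}"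
    have "(\<Sum>X\<in>?S m. ?g X) = (\<Sum>X\<in>?S m. real d + (if X \<in> ?S m - ?C then 1 else 0))"
      using False by (intro sum.cong) auto
    also have "\<dots> = real (D choose m) * real d + real (card (?S m - ?C))"
    proof -
      have "(\<Sum>X\<in>?S m. if X \<in> ?S m - ?C then 1 else 0 :: real)
          = (\<Sum>X\<in>?S m - ?C. 1)"
        by (rule sum.mono_neutral_cong_right) (use finS in auto)
      then show ?thesis
        unfolding sum.distrib sum_constant cardS by simp
    qed
    also have "real (card (?S m - ?C)) = real (D choose m) - real (card ?C)"
    proof -
      have sub: "?C \<subseteq> ?S m"
        by auto
      then have "card (?S m - ?C) = card (?S m) - card ?C"
        by (intro card_Diff_subset finite_subset[OF sub finS])
      moreover have "card ?C \<le> card (?S m)"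
        by (rule card_mono[OF finS sub])
      ultimately show ?thesis
        unfolding cardS by simp
    qed
    finally have "(\<Sum>X\<in>?S m. ?g X)
        = real (D choose m) * real d + (real (D choose m) - real (card ?C))" .
    \<comment> \<open>The sets satisfying \<open>Q\<close> are at most as many as the
      \<open>m\<close>-sets avoiding one fixed point, which form the fraction
      \<open>1 - m / D\<close> of all.\<close>
    moreover have "real (card ?C) \<le> real ((D - 1) choose m)"
      using card_union_closed_family_le[of N Q "d - 1" m] fin nQ Un False d
      unfolding D_def by auto
    moreover have "real (D - m) * real (D choose m) = real D * real ((D - 1) choose m)"
      using binomial_absorb_comp[of D m] by (metis of_nat_mult)
    then have "real ((D - 1) choose m) = real (D choose m) - real m * (1 / real D) * real (D choose m)"
      using m dD by (simp add: field_simps)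
    ultimately show ?thesis
      using False by (simp add: h_def algebra_simps)
  qed
  have "real d * (real D + 1) \<le> (\<Sum>m\<le>D. h m)"
  proof -
    have "real (d * (d + 1)) \<le> real D"
      using large unfolding D_def by (rule of_nat_mono)
    then have "0 \<le> real D - real d * (real d + 1)"
      by (simp add: algebra_simps)
    \<comment> \<open>This is the exact surplus of the sum of the \<open>h m\<close> over
      \<open>d * (D + 1)\<close>; its sign is what asks for \<open>d * (d + 1)\<close>
      neighbours.\<close>
    then have "0 \<le> (real D + 1) * (real D - real d * (real d + 1)) / real D / 2"
      by (intro divide_nonneg_nonneg mult_nonneg_nonneg) auto
    also have "\<dots> = (\<Sum>m\<le>D. h m) - real d * (real D + 1)"
      unfolding h_def sum_truncated_linear[OF dD(1)] using dD by (simp add: field_simps)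
    finally show ?thesis
      by simp
  qed
  also have "\<dots> \<le> (\<Sum>m\<le>D. \<Sum>X\<in>?S m. ?g X / real (D choose card X))"
  proof (rule sum_mono)
    fix m assume "m \<in> {..D}"
    then have m: "m \<le> D" "0 < real (D choose m)"
      by auto
    have "h m \<le> (\<Sum>X\<in>?S m. ?g X) / real (D choose m)"
      using level[OF m(1)] m(2) by (simp add: pos_le_divide_eq)
    also have "\<dots> = (\<Sum>X\<in>?S m. ?g X / real (D choose card X))"
      unfolding sum_divide_distrib by (intro sum.cong) auto
    finally show "h m \<le> (\<Sum>X\<in>?S m. ?g X / real (D choose card X))" .
  qed
  also have "\<dots> = (\<Sum>X\<in>Pow N. ?g X / real (D choose card X))"
    using fin unfolding D_def by (intro sum.group) (auto intro: card_mono)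
  also have "\<dots> = (real D + 1) * segment_mean ?g N"
    unfolding segment_mean_def sum_distrib_left D_def
    by (intro sum.cong refl) (simp add: add_nonneg_eq_0_iff)
  finally show ?thesis
    by (simp add: mult.commute[of "real d"])
qed

section \<open>Connectivity\<close>

definition neighbours :: "'a set set \<Rightarrow> 'a \<Rightarrow> 'a set" where
  "neighbours E v = {u. {v, u} \<in> E}"

lemma neighbours_irrefl: "E \<subseteq> [U]\<^bsup>2\<^esup> \<Longrightarrow> v \<notin> neighbours E v"
  by (auto simp: neighbours_def nsets_def)

lemma neighbours_subset: "E \<subseteq> [U]\<^bsup>2\<^esup> \<Longrightarrow> neighbours E v \<subseteq> U - {v}"
  by (auto simp: neighbours_def nsets_def)

lemma k_connected_mono:
  assumes "k_connected k (U, E)" "E \<subseteq> E'"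
  shows "k_connected k (U, E')"
proof -
  have "{(x, y). {x, y} \<in> {e \<in> E. e \<inter> X = {}}}\<^sup>* \<subseteq> {(x, y). {x, y} \<in> {e \<in> E'. e \<inter> X = {}}}\<^sup>*" for X
    using assms(2) by (intro rtrancl_mono) auto
  then have "connected_graph (delete_vertices (U, E') X)"
    if "connected_graph (delete_vertices (U, E) X)" for X
    using that unfolding connected_graph_def delete_vertices_def fst_conv snd_conv by blast
  then show ?thesis
    using assms(1) unfolding k_connected_def fst_conv by blast
qed

text \<open>With fewer than \<open>k\<close> neighbours, deleting them would cut \<open>v\<close>
  off from a further vertex, which exists since \<open>card U > k\<close>.\<close>

lemma k_connected_degree:
  assumes conn: "k_connected k (U, E)" and E: "E \<subseteq> [U]\<^bsup>2\<^esup>" and v: "v \<in> U"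
  shows "k \<le> card (neighbours E v)"
proof (rule ccontr)
  let ?X = "neighbours E v"
  assume "\<not> k \<le> card ?X"
  then have less: "card ?X < k"
    by simp
  have U: "k < card U"
    using conn by (simp add: k_connected_def)
  then have "finite U"
    by (metis card.infinite not_less_zero)
  then have fX: "finite ?X"
    using neighbours_subset[OF E] finite_subset by blast
  then have "card (insert v ?X) < card U"
    using less U by (simp add: card_insert_if)
  then have "\<not> U \<subseteq> insert v ?X"
    using fX card_mono[of "insert v ?X" U] by auto
  then obtain w where w: "w \<in> U" "w \<noteq> v" "w \<notin> ?X"
    by auto
  have "connected_graph (delete_vertices (U, E) ?X)"
    using conn less neighbours_subset[OF E, of v] unfolding k_connected_def by auto
  then have "(v, w) \<in> {(x, y). {x, y} \<in> {e \<in> E. e \<inter> ?X = {}}}\<^sup>*"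
    using v w neighbours_irrefl[OF E] unfolding connected_graph_def delete_vertices_def by auto
  then show False
    using w(2) by (cases rule: converse_rtranclE) (auto simp: neighbours_def)
qed

text \<open>A walk through \<open>v\<close> can skip it: the vertices before and after
  \<open>v\<close> are neighbours of \<open>v\<close>, hence equal or adjacent. The bound on
  \<open>card U\<close> leaves more than \<open>k\<close> vertices.\<close>

lemma k_connected_delete_simplicial:
  assumes conn: "k_connected k (U, E)" and E: "E \<subseteq> [U]\<^bsup>2\<^esup>" and v: "v \<in> U"
    and simplicial: "[neighbours E v]\<^bsup>2\<^esup> \<subseteq> E" and card: "k + 1 < card U"
  shows "k_connected k (U - {v}, E \<inter> [U - {v}]\<^bsup>2\<^esup>)"
proof -
  have fin: "finite U"
    using card by (metis card.infinite not_less_zero)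
  have "connected_graph (delete_vertices (U - {v}, E \<inter> [U - {v}]\<^bsup>2\<^esup>) X)"
    if X: "X \<subseteq> U - {v}" "card X < k" for X
  proof -
    let ?R = "{(x, y). {x, y} \<in> {e \<in> E. e \<inter> X = {}}}"
    let ?R' = "{(x, y). {x, y} \<in> {e \<in> E \<inter> [U - {v}]\<^bsup>2\<^esup>. e \<inter> X = {}}}"
    have "finite X"
      using X(1) fin finite_subset by blast
    then have "card X < card (U - {v})"
      using X card v fin by simp
    then have "U - {v} - X \<noteq> {}"
      using X(1) by auto
    moreover have "(a, b) \<in> ?R'\<^sup>*" if a: "a \<in> U - {v} - X" and b: "b \<in> U - {v} - X" for a b
    proof -
      have R'I: "(x, y) \<in> ?R'" if "(x, y) \<in> ?R" "x \<noteq> v" "y \<noteq> v" for x y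
        using that E by (auto simp: nsets_def)
      have "connected_graph (delete_vertices (U, E) X)"
        using conn X unfolding k_connected_def by auto
      then have "(a, b) \<in> ?R\<^sup>*"
        using a b unfolding connected_graph_def delete_vertices_def by auto
      \<comment> \<open>The invariant for a walk standing at \<open>v\<close> is that every
        surviving neighbour of \<open>v\<close> is already reachable without \<open>v\<close>, so
        the step leaving \<open>v\<close> is immediate.\<close>
      then have "(b \<noteq> v \<longrightarrow> (a, b) \<in> ?R'\<^sup>*) \<and>
          (b = v \<longrightarrow> (\<forall>u\<in>neighbours E v - X. (a, u) \<in> ?R'\<^sup>*))"
      proof (induction rule: rtrancl_induct)
        case base
        then show ?case
          using a by auto
      next
        case (step b c)
        have bc: "{b, c} \<in> E" "b \<notin> X" "c \<notin> X" "b \<noteq> c"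
          using step.hyps(2) E by (auto simp: nsets_def)
        consider "b \<noteq> v" "c \<noteq> v" | "b = v" "c \<noteq> v" | "b \<noteq> v" "c = v"
          using bc(4) by auto
        then show ?case
        proof cases
          case 1
          then show ?thesis
            using step.IH R'I[OF step.hyps(2)] by (auto intro: rtrancl_into_rtrancl)
        next
          case 2
          then show ?thesis
            using step.IH bc by (auto simp: neighbours_def)
        next
          case 3
          have nb: "b \<in> neighbours E v"
            using bc(1) 3 by (simp add: neighbours_def insert_commute)
          have "(a, u) \<in> ?R'\<^sup>*" if u: "u \<in> neighbours E v - X" for u
          proof (cases "u = b")
            case True
            then show ?thesis
              using step.IH 3 by auto
          next
            case False
            then have "{b, u} \<in> E"
              using simplicial nb u by auto
            then have "(b, u) \<in> ?R"
              using u bc(2) by auto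
            then have "(b, u) \<in> ?R'"
              using R'I 3 u neighbours_irrefl[OF E, of v] by blast
            then show ?thesis
              using step.IH 3 by (auto intro: rtrancl_into_rtrancl)
          qed
          then show ?thesis
            using 3 by simp
        qed
      qed
      then show ?thesis
        using b by auto
    qed
    ultimately show ?thesis
      unfolding connected_graph_def delete_vertices_def by auto
  qed
  then show ?thesis
    using card fin v unfolding k_connected_def by auto
qed

section \<open>Extendable rigidity matroids\<close>

lemma Union_complete:
  assumes "a \<in> W" "b \<in> W" "a \<noteq> b"
  shows "\<Union>([W]\<^bsup>2\<^esup>) = W"
proof
  show "W \<subseteq> \<Union>([W]\<^bsup>2\<^esup>)"
  proof
    fix x assume "x \<in> W"
    then have "{x, a} \<in> [W]\<^bsup>2\<^esup> \<or> {x, b} \<in> [W]\<^bsup>2\<^esup>"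
      using assms by auto
    then show "x \<in> \<Union>([W]\<^bsup>2\<^esup>)"
      by blast
  qed
qed (auto simp: nsets_def)

lemma complete_Union_complete: "[\<Union>([W]\<^bsup>2\<^esup>)]\<^bsup>2\<^esup> = [W]\<^bsup>2\<^esup>"
  by (auto simp: nsets_def)

lemma star_subset_complete:
  assumes "S \<subseteq> W" "v \<in> W" "v \<notin> S"
  shows "(\<lambda>s. {v, s}) ` S \<subseteq> [W]\<^bsup>2\<^esup>"
proof clarify
  fix s assume "s \<in> S"
  then have "s \<in> W" "v \<noteq> s"
    using assms by auto
  then show "{v, s} \<in> [W]\<^bsup>2\<^esup>"
    using assms(2) by simp
qed

lemma complete_insert_subset: "[insert v A]\<^bsup>2\<^esup> \<subseteq> [A]\<^bsup>2\<^esup> \<union> (\<lambda>s. {v, s}) ` A"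
proof
  fix e assume "e \<in> [insert v A]\<^bsup>2\<^esup>"
  then obtain x y where e: "e = {x, y}" and xy: "x \<in> insert v A" "y \<in> insert v A" "x \<noteq> y"
    by (rule nsets2_E)
  from xy consider "x \<in> A" "y \<in> A" | "x = v" "y \<in> A" | "y = v" "x \<in> A"
    by auto
  then show "e \<in> [A]\<^bsup>2\<^esup> \<union> (\<lambda>s. {v, s}) ` A"
    by cases (use e xy in \<open>simp_all add: insert_commute\<close>)
qed

section \<open>Cliques in closed edge sets and the rank of complete graphs\<close>

locale extendable_rigidity_matroid = abstract_rigidity_matroid d V \<I>
  for d :: nat and V :: "'a set" and \<I> :: "'a set set set" +
  assumes finite_V: "finite V"
    and d_pos: "1 \<le> d"
    and extendable: "one_extendable d V \<I>"
begin

text \<open>The first rigidity axiom with an empty second set: the empty intersection has fewer than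
  \<open>d\<close> elements because \<open>d\<close> is positive.\<close>

lemma cl_subset_complete:
  assumes "E \<subseteq> [V]\<^bsup>2\<^esup>"
  shows "cl E \<subseteq> [\<Union>E]\<^bsup>2\<^esup>"
  using closure_Un_subset[OF assms, of "{}"] d_pos by (simp add: nsets_eq_empty)

lemma rigid_complete:
  assumes "W \<subseteq> V"
  shows "rigid_edge_set V \<I> ([W]\<^bsup>2\<^esup>)"
  unfolding rigid_edge_set_def
  using cl_subset_complete subset_cl nsets_mono[OF assms]
  by (metis complete_Union_complete subset_antisym)

text \<open>By the second rigidity axiom the union of the two cliques spans the complete graph on
  \<open>A \<union> B\<close>, and a closed \<open>E\<close> contains whatever its subsets
  span.\<close>

lemma clique_Un:
  assumes "cl E \<subseteq> E" "A \<subseteq> V" "B \<subseteq> V" "[A]\<^bsup>2\<^esup> \<subseteq> E" "[B]\<^bsup>2\<^esup> \<subseteq> E" "d \<le> card (A \<inter> B)"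
  shows "[A \<union> B]\<^bsup>2\<^esup> \<subseteq> E"
\<comment> \<open>The axiom sees only endpoints of edges, so a one-vertex clique would be invisible.
  If neither set contains the other, both have at least two vertices.\<close>
proof (cases "A \<subseteq> B \<or> B \<subseteq> A")
  case True
  then show ?thesis
    using assms(4,5) by (metis sup.absorb1 sup.absorb2)
next
  case False
  then obtain a b where ab: "a \<in> A" "a \<notin> B" "b \<in> B" "b \<notin> A"
    by blast
  have "A \<inter> B \<noteq> {}"
    using assms(6) d_pos by auto
  then obtain c where c: "c \<in> A" "c \<in> B"
    by blast
  have A: "\<Union>([A]\<^bsup>2\<^esup>) = A" and B: "\<Union>([B]\<^bsup>2\<^esup>) = B"
    using ab c by (metis Union_complete)+
  have "rigid_edge_set V \<I> ([A]\<^bsup>2\<^esup> \<union> [B]\<^bsup>2\<^esup>)"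
    using assms A B by (intro rigid_Un rigid_complete nsets_mono) auto
  then have "[A \<union> B]\<^bsup>2\<^esup> = cl ([A]\<^bsup>2\<^esup> \<union> [B]\<^bsup>2\<^esup>)"
    using A B by (simp add: rigid_edge_set_def)
  also have "\<dots> \<subseteq> cl E"
    using assms by (intro cl_mono) auto
  finally show ?thesis
    using assms(1) by simp
qed

text \<open>Joining a new vertex to \<open>d\<close> vertices of a complete graph already spans the
  larger complete graph, so each vertex beyond the first \<open>d\<close> adds at most
  \<open>d\<close> to the rank. The base is \<open>d choose 2 < d * d\<close>.\<close>

lemma rank_complete_less:
  assumes "W \<subseteq> V" "d \<le> card W"
  shows "rank ([W]\<^bsup>2\<^esup>) < d * card W"
  using assms(2,1)
proof (induction "card W" arbitrary: W rule: nat_induct_at_least)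
  case base
  have fin: "finite W"
    using base finite_V finite_subset by blast
  have "rank ([W]\<^bsup>2\<^esup>) \<le> card ([W]\<^bsup>2\<^esup>)"
    using fin by (intro rank_le_card finite_imp_finite_nsets)
  also have "\<dots> = card W choose 2"
    by simp
  also have "\<dots> < d * card W"
    using base d_pos by (simp add: choose_two div_less_iff_less_mult)
  finally show ?case .
next
  case (Suc n)
  have fin: "finite W"
    using Suc.prems finite_V finite_subset by blast
  obtain v where v: "v \<in> W"
    using Suc.hyps by fastforce
  let ?W = "W - {v}"
  have cW: "card ?W = n"
    using fin v Suc.hyps by simp
  then obtain S where S: "S \<subseteq> ?W" "card S = d" "finite S"
    using Suc.hyps(1) obtain_subset_with_card_n by metis
  let ?E = "[?W]\<^bsup>2\<^esup> \<union> (\<lambda>s. {v, s}) ` S"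
  have E: "?E \<subseteq> [V]\<^bsup>2\<^esup>"
  proof -
    have "[?W]\<^bsup>2\<^esup> \<subseteq> [V]\<^bsup>2\<^esup>"
      using Suc.prems by (intro nsets_mono) auto
    moreover have "(\<lambda>s. {v, s}) ` S \<subseteq> [V]\<^bsup>2\<^esup>"
      using S(1) Suc.prems v by (intro star_subset_complete) auto
    ultimately show ?thesis
      by simp
  qed
  have "[insert v S]\<^bsup>2\<^esup> \<subseteq> ?E"
    using complete_insert_subset[of v S] nsets_mono[OF S(1), of 2] by blast
  then have "[insert v S]\<^bsup>2\<^esup> \<subseteq> cl ?E" "[?W]\<^bsup>2\<^esup> \<subseteq> cl ?E"
    using subset_cl[OF E] by blast+
  moreover have "?W \<inter> insert v S = S"
    using S by auto
  ultimately have "[?W \<union> insert v S]\<^bsup>2\<^esup> \<subseteq> cl ?E"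
    using S Suc.prems v cl_idem[OF E] by (intro clique_Un) auto
  moreover have "?W \<union> insert v S = W"
    using S v by auto
  ultimately have "rank ([W]\<^bsup>2\<^esup>) \<le> rank (cl ?E)"
    by (intro rank_mono) simp
  also have "\<dots> = rank ?E"
    by (rule rank_cl[OF E])
  also have "\<dots> \<le> rank ([?W]\<^bsup>2\<^esup>) + card ((\<lambda>s. {v, s}) ` S)"
    using S by (intro rank_Un_le) simp
  also have "\<dots> \<le> rank ([?W]\<^bsup>2\<^esup>) + d"
    using S card_image_le[of S] by fastforce
  also have "\<dots> < d * card ?W + d"
    using Suc.hyps(2)[of ?W] cW Suc.prems by auto
  also have "\<dots> = d * card W"
    by (simp add: cW flip: Suc.hyps(3))
  finally show ?case .
qed

section \<open>Extensions and the rank gained at a vertex\<close>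

text \<open>Edges at \<open>v\<close> are added one by one. As long as the star meets
  \<open>F\<close> in fewer than \<open>d\<close> vertices, the first axiom confines the closure to
  two complete graphs: the one missing \<open>v\<close>, the other missing the next end
  \<open>s\<close>.\<close>

lemma zero_extension_indep:
  assumes "F \<in> \<I>" "F \<subseteq> [W]\<^bsup>2\<^esup>" "W \<subseteq> V" "v \<in> V" "v \<notin> W" "finite S" "S \<subseteq> W" "card S \<le> d"
  shows "F \<union> (\<lambda>s. {v, s}) ` S \<in> \<I>"
  using assms(6-8)
proof (induction S)
  case empty
  then show ?case
    using assms(1) by simp
next
  case (insert s S)
  let ?T = "(\<lambda>s. {v, s}) ` S"
  have FV: "F \<subseteq> [V]\<^bsup>2\<^esup>"
    using assms(2,3) nsets_mono by blast
  have TV: "?T \<subseteq> [V]\<^bsup>2\<^esup>"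
    using assms(3-5) insert.prems by (intro star_subset_complete) auto
  have UF: "\<Union>F \<subseteq> W"
    using assms(2) by (auto simp: nsets_def)
  have UT: "\<Union>?T \<subseteq> insert v S"
    by auto
  have "card (\<Union>F \<inter> \<Union>?T) \<le> card S"
    using UF UT assms(5) insert.hyps(1) by (intro card_mono) auto
  then have "card (\<Union>F \<inter> \<Union>?T) < d"
    using insert by simp
  then have sub: "cl (F \<union> ?T) \<subseteq> [\<Union>F]\<^bsup>2\<^esup> \<union> [\<Union>?T]\<^bsup>2\<^esup>"
    by (rule closure_Un_subset[OF FV TV])
  have "v \<notin> \<Union>F" "s \<notin> \<Union>?T"
    using UF UT assms(5) insert by auto
  then have "{v, s} \<notin> cl (F \<union> ?T)"
    using sub by auto
  then have "insert {v, s} (F \<union> ?T) \<in> \<I>"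
    using insert assms(3-5) by (intro insert_indep) auto
  then show ?case
    by simp
qed

text \<open>Since \<open>{x, y}\<close> lies outside the closed set \<open>E\<close>, it can be
  added to \<open>F\<close> independently; the 1-extension on this edge then removes it again and
  leaves \<open>F\<close> with the star.\<close>

lemma one_extension_indep:
  assumes "F \<in> \<I>" "F \<subseteq> [W]\<^bsup>2\<^esup>" "F \<subseteq> E" "cl E \<subseteq> E" "W \<subseteq> V" "v \<in> V" "v \<notin> W"
    and "finite S" "S \<subseteq> W" "card S = d + 1" "x \<in> S" "y \<in> S" "x \<noteq> y" "{x, y} \<notin> E"
  shows "F \<union> (\<lambda>s. {v, s}) ` S \<in> \<I>"
proof -
  let ?G = "(W, insert {x, y} F)"
  let ?G' = "(insert v W, F \<union> (\<lambda>s. {v, s}) ` S)"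
  have "{x, y} \<notin> cl F"
    using assms(14) cl_mono[OF assms(3)] assms(4) by auto
  then have ind: "insert {x, y} F \<in> \<I>"
    using assms by (intro insert_indep) auto
  have "card (S - {x, y}) = card {3..d + 1}"
    using assms by (simp add: card_Diff_subset)
  then obtain h where h: "bij_betw h {3..d + 1} (S - {x, y})"
    using assms(8) finite_same_card_bij[of "{3..d + 1}" "S - {x, y}"] by auto
  \<comment> \<open>The enumeration of \<open>S\<close> must begin with the ends of the edge to be
    deleted; \<open>h\<close> numbers the other \<open>d - 1\<close> vertices from 3 on.\<close>
  define w where "w i = (if i = 1 then x else if i = 2 then y else h i)" for i :: nat
  have split: "{1..d + 1} = insert 1 (insert 2 {3..d + 1})"
    using d_pos by auto
  have "w ` {3..d + 1} = h ` {3..d + 1}"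
    by (intro image_cong) (auto simp: w_def)
  then have im3: "w ` {3..d + 1} = S - {x, y}"
    using h by (simp add: bij_betw_def)
  have w12: "w 1 = x" "w 2 = y"
    by (auto simp: w_def)
  have im: "w ` {1..d + 1} = S"
    unfolding split using im3 w12 assms(11,12) by auto
  then have inj: "inj_on w {1..d + 1}"
    using assms(10) by (intro eq_card_imp_inj_on) auto
  have star: "{{v, w i} | i. i \<in> {1..d + 1}} = (\<lambda>s. {v, s}) ` S"
    unfolding im[symmetric] by auto
  have "{x, y} \<notin> F"
    using assms(3,14) by auto
  then have "?G' = (insert v (fst ?G), (snd ?G - {{w 1, w 2}}) \<union> {{v, w i} | i. i \<in> {1..d + 1}})"
    unfolding star w12 by simp
  then have "one_extension d ?G ?G'"
    unfolding one_extension_def using inj im w12 assms(7,9) by (intro exI[of _ v] exI[of _ w]) auto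
  moreover have "subgraph ?G (V, [V]\<^bsup>2\<^esup>)"
    using assms nsets_mono[of W V 2] by (auto simp: subgraph_def)
  moreover have "subgraph ?G' (V, [V]\<^bsup>2\<^esup>)"
  proof -
    have "(\<lambda>s. {v, s}) ` S \<subseteq> [insert v W]\<^bsup>2\<^esup>"
      using assms(7,9) by (intro star_subset_complete) auto
    moreover have "F \<subseteq> [insert v W]\<^bsup>2\<^esup>"
      using assms(2) nsets_mono[of W "insert v W" 2] by auto
    moreover have "[insert v W]\<^bsup>2\<^esup> \<subseteq> [V]\<^bsup>2\<^esup>"
      using assms(5,6) by (intro nsets_mono) auto
    ultimately show ?thesis
      using assms(5,6) by (auto simp: subgraph_def)
  qed
  ultimately show ?thesis
    using extendable ind unfolding one_extendable_def by fastforce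
qed

text \<open>A basis \<open>F\<close> of the edges inside \<open>W - {v}\<close> is enlarged by a
  star at \<open>v\<close>: by a 1-extension if \<open>X\<close> has more than \<open>d\<close>
  vertices and a non-adjacent pair, by a 0-extension otherwise.\<close>

lemma rank_vertex_gain:
  assumes E: "E \<subseteq> [V]\<^bsup>2\<^esup>" "cl E \<subseteq> E" and W: "W \<subseteq> V" "v \<in> W"
  defines "X \<equiv> neighbours E v \<inter> W"
  shows "rank (E \<inter> [W - {v}]\<^bsup>2\<^esup>)
      + (min d (card X) + (if d < card X \<and> \<not> [X]\<^bsup>2\<^esup> \<subseteq> E then 1 else 0))
    \<le> rank (E \<inter> [W]\<^bsup>2\<^esup>)"
proof -
  obtain F where F: "F \<in> \<I>" "F \<subseteq> E \<inter> [W - {v}]\<^bsup>2\<^esup>" "card F = rank (E \<inter> [W - {v}]\<^bsup>2\<^esup>)"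
    by (rule obtain_basis)
  have XW: "X \<subseteq> W - {v}"
    using neighbours_irrefl[OF E(1)] unfolding X_def by auto
  have fX: "finite X"
    using XW W(1) finite_V by (meson finite_Diff finite_subset)
  have step: "rank (E \<inter> [W - {v}]\<^bsup>2\<^esup>) + card S \<le> rank (E \<inter> [W]\<^bsup>2\<^esup>)"
    if S: "S \<subseteq> X" "F \<union> (\<lambda>s. {v, s}) ` S \<in> \<I>" for S
  proof -
    have "finite S"
      using S(1) fX finite_subset by blast
    moreover have "inj_on (\<lambda>s. {v, s}) S"
      by (auto simp: inj_on_def doubleton_eq_iff)
    moreover have "F \<inter> (\<lambda>s. {v, s}) ` S = {}"
      using F(2) by (auto simp: nsets_def)
    ultimately have "card (F \<union> (\<lambda>s. {v, s}) ` S) = card F + card S"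
      using finite_indep[OF F(1)] by (simp add: card_Un_disjoint card_image)
    moreover have "(\<lambda>s. {v, s}) ` S \<subseteq> E \<inter> [W]\<^bsup>2\<^esup>"
      using S(1) XW W(2) unfolding X_def by (auto simp: neighbours_def)
    then have "card (F \<union> (\<lambda>s. {v, s}) ` S) \<le> rank (E \<inter> [W]\<^bsup>2\<^esup>)"
      using F(2) nsets_mono[of "W - {v}" W 2] by (intro card_le_rank S(2)) auto
    ultimately show ?thesis
      using F(3) by simp
  qed
  show ?thesis
  proof (cases "d < card X \<and> \<not> [X]\<^bsup>2\<^esup> \<subseteq> E")
    case True
    then obtain e where e: "e \<in> [X]\<^bsup>2\<^esup>" "e \<notin> E"
      by blast
    from e(1) obtain x y where "e = {x, y}" and xy: "x \<in> X" "y \<in> X" "x \<noteq> y"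
      by (rule nsets2_E)
    with e(2) have nE: "{x, y} \<notin> E"
      by simp
    \<comment> \<open>Any \<open>d - 1\<close> further vertices complete the non-adjacent pair to
      the \<open>d + 1\<close> ends of a 1-extension.\<close>
    have "d - 1 \<le> card (X - {x, y})"
      using True xy diff_le_mono[of "Suc d" "card X" 2] by (simp add: card_Diff_subset)
    then obtain T where T: "T \<subseteq> X - {x, y}" "card T = d - 1" "finite T"
      by (rule obtain_subset_with_card_n)
    let ?S = "insert x (insert y T)"
    have "card ?S = d + 1"
      using T xy d_pos by (subst card_insert_disjoint, auto)+
    moreover have SX: "?S \<subseteq> X"
      using T xy by auto
    ultimately have "F \<union> (\<lambda>s. {v, s}) ` ?S \<in> \<I>"
      using F E W XW T xy nE by (intro one_extension_indep[of F "W - {v}" E v ?S x y]) auto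
    then show ?thesis
      using step[OF SX] True \<open>card ?S = d + 1\<close> by simp
  next
    case False
    obtain S where S: "S \<subseteq> X" "card S = min d (card X)" "finite S"
      using obtain_subset_with_card_n[of "min d (card X)" X] by auto
    have "F \<union> (\<lambda>s. {v, s}) ` S \<in> \<I>"
      using F W XW S by (intro zero_extension_indep[of F "W - {v}"]) auto
    then show ?thesis
      using step[OF S(1)] False S(2) by auto
  qed
qed

section \<open>Closed highly connected graphs\<close>

lemma closed_highly_connected_complete:
  assumes "U \<subseteq> V" "E \<subseteq> [U]\<^bsup>2\<^esup>" "cl E \<subseteq> E" "k_connected (d * (d + 1)) (U, E)"
  shows "E = [U]\<^bsup>2\<^esup>"
  using assms
proof (induction "card U" arbitrary: U E rule: less_induct)
  case less
  note U = less.prems(1) and E = less.prems(2) and closed = less.prems(3) and conn = less.prems(4)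
  let ?N = "neighbours E"
  have fin: "finite U"
    using U finite_V finite_subset by blast
  have EV: "E \<subseteq> [V]\<^bsup>2\<^esup>"
    using E nsets_mono[OF U] by blast
  have cardU: "d * (d + 1) < card U"
    using conn by (simp add: k_connected_def)
  have deg: "d * (d + 1) \<le> card (?N v)" if "v \<in> U" for v
    using k_connected_degree[OF conn E that] .
  have NU: "?N v \<subseteq> U - {v}" for v
    by (rule neighbours_subset[OF E])
  have d_le: "d \<le> d * (d + 1)"
    by simp
  have star: "[insert v A]\<^bsup>2\<^esup> \<subseteq> E" if "A \<subseteq> ?N v" "[A]\<^bsup>2\<^esup> \<subseteq> E" for v A
    using complete_insert_subset[of v A] that by (auto simp: neighbours_def)
  show ?case
  proof (cases "\<exists>v\<in>U. [?N v]\<^bsup>2\<^esup> \<subseteq> E")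
    case True
    then obtain v where v: "v \<in> U" "[?N v]\<^bsup>2\<^esup> \<subseteq> E"
      by blast
    have "[U - {v}]\<^bsup>2\<^esup> \<subseteq> E"
    \<comment> \<open>At this smallest order, deleting \<open>v\<close> would leave too few vertices
      for \<open>k_connected\<close>; but then the degree bound makes \<open>v\<close> adjacent to
      all others.\<close>
    proof (cases "card U = d * (d + 1) + 1")
      case True
      then have "?N v = U - {v}"
        using NU[of v] deg[OF v(1)] v(1) fin by (intro card_seteq) auto
      then show ?thesis
        using v(2) by simp
    next
      case False
      let ?E = "E \<inter> [U - {v}]\<^bsup>2\<^esup>"
      have "cl ?E \<subseteq> ?E"
      proof -
        have "cl ?E \<subseteq> cl E"
          by (intro cl_mono) auto
        moreover have "cl ?E \<subseteq> [\<Union>?E]\<^bsup>2\<^esup>"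
          using EV by (intro cl_subset_complete) auto
        moreover have "[\<Union>?E]\<^bsup>2\<^esup> \<subseteq> [U - {v}]\<^bsup>2\<^esup>"
          by (intro nsets_mono) (auto simp: nsets_def)
        ultimately show ?thesis
          using closed by blast
      qed
      moreover have "k_connected (d * (d + 1)) (U - {v}, ?E)"
        using False cardU v by (intro k_connected_delete_simplicial[OF conn E]) auto
      moreover have "card (U - {v}) < card U"
        using fin v(1) by (rule card_Diff1_less)
      ultimately have "?E = [U - {v}]\<^bsup>2\<^esup>"
        using U by (intro less.hyps) auto
      then show ?thesis
        by auto
    qed
    \<comment> \<open>The cliques on \<open>U - {v}\<close> and \<open>insert v (?N v)\<close> share
      all neighbours of \<open>v\<close>, at least \<open>d\<close> of them, so they merge into one
      clique.\<close>
    moreover have "(U - {v}) \<inter> insert v (?N v) = ?N v"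
      using NU[of v] by auto
    ultimately have "[U - {v} \<union> insert v (?N v)]\<^bsup>2\<^esup> \<subseteq> E"
      using U NU[of v] v star[of "?N v" v] deg[OF v(1)] le_trans[OF d_le deg[OF v(1)]] closed
      by (intro clique_Un) auto
    moreover have "U - {v} \<union> insert v (?N v) = U"
      using NU[of v] v by auto
    ultimately show ?thesis
      using E by auto
  next
    case False
    let ?g = "\<lambda>X. real (min d (card X) + (if d < card X \<and> \<not> [X]\<^bsup>2\<^esup> \<subseteq> E then 1 else 0))"
    have mean: "real d \<le> segment_mean ?g (?N v)" if v: "v \<in> U" for v
    proof (rule segment_mean_ge)
      show "finite (?N v)"
        using NU fin by (meson finite_Diff finite_subset)
      fix A B
      assume AB: "A \<subseteq> ?N v" "B \<subseteq> ?N v" "[A]\<^bsup>2\<^esup> \<subseteq> E" "[B]\<^bsup>2\<^esup> \<subseteq> E" "d - 1 \<le> card (A \<inter> B)"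
      have "finite (A \<inter> B)" "v \<notin> A \<inter> B"
        using AB(1) NU[of v] fin by (auto intro: finite_subset)
      \<comment> \<open>Including \<open>v\<close> raises the overlap from \<open>d - 1\<close> to
        the \<open>d\<close> that \<open>clique_Un\<close> requires.\<close>
      then have "d \<le> card (insert v A \<inter> insert v B)"
        using AB(5) by simp
      then have "[insert v A \<union> insert v B]\<^bsup>2\<^esup> \<subseteq> E"
        using AB star[of A v] star[of B v] NU[of v] U v closed by (intro clique_Un) auto
      then show "[A \<union> B]\<^bsup>2\<^esup> \<subseteq> E"
        using nsets_mono[of "A \<union> B" "insert v A \<union> insert v B" 2] by blast
    qed (use False v deg d_pos in auto)
    have "real (d * card U) = (\<Sum>v\<in>U. real d)"
      by simp
    also have "\<dots> \<le> (\<Sum>v\<in>U. segment_mean ?g (?N v \<inter> U))"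
    proof (rule sum_mono)
      fix v assume "v \<in> U"
      moreover have "?N v \<inter> U = ?N v"
        using NU[of v] by auto
      ultimately show "real d \<le> segment_mean ?g (?N v \<inter> U)"
        using mean by simp
    qed
    also have "\<dots> \<le> real (rank (E \<inter> [U]\<^bsup>2\<^esup>))"
    \<comment> \<open>The rank of the edges inside \<open>W\<close> stands for the size of the
      independent set kept so far, so no particular order has to be chosen.\<close>
    proof (rule sum_segment_mean_le[OF fin, where r = "\<lambda>W. real (rank (E \<inter> [W]\<^bsup>2\<^esup>))"])
      fix v W assume W: "W \<subseteq> U" "v \<in> W"
      then have "W \<subseteq> V"
        using U by auto
      from rank_vertex_gain[OF EV closed this W(2)]
      show "real (rank (E \<inter> [W - {v}]\<^bsup>2\<^esup>)) + ?g (?N v \<inter> W) \<le> real (rank (E \<inter> [W]\<^bsup>2\<^esup>))"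
        unfolding of_nat_add[symmetric] of_nat_le_iff .
    qed (auto simp: neighbours_irrefl[OF E])
    finally have "d * card U \<le> rank (E \<inter> [U]\<^bsup>2\<^esup>)"
      unfolding of_nat_le_iff .
    also have "\<dots> \<le> rank ([U]\<^bsup>2\<^esup>)"
      by (intro rank_mono) auto
    also have "\<dots> < d * card U"
      using cardU d_le by (intro rank_complete_less U) linarith
    finally show ?thesis
      by simp
  qed
qed

end

theorem theorem6p2:
  fixes d :: nat and V U :: "'a set" and E :: "'a set set" and \<I> :: "'a set set set"
  assumes "finite V"
    and "d \<ge> 1"
    and "abstract_rigidity_matroid d V \<I>"
    and "one_extendable d V \<I>"
    and "subgraph (U, E) (V, [V]\<^bsup>2\<^esup>)"
    and "k_connected (d * (d + 1)) (U, E)"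
  shows "rigid_graph V \<I> (U, E)"
proof -
  interpret extendable_rigidity_matroid d V \<I>
    using assms(1-4)
    by (intro extendable_rigidity_matroid.intro extendable_rigidity_matroid_axioms.intro)
  have U: "U \<subseteq> V" and E: "E \<subseteq> [U]\<^bsup>2\<^esup>" and EV: "E \<subseteq> [V]\<^bsup>2\<^esup>"
    using assms(5) by (auto simp: subgraph_def)
  \<comment> \<open>The closure gains no vertices outside \<open>U\<close>, so \<open>cl E\<close>
    is a closed edge set on \<open>U\<close> that inherits the connectivity of
    \<open>E\<close>.\<close>
  have "cl E \<subseteq> [\<Union>E]\<^bsup>2\<^esup>"
    by (rule cl_subset_complete[OF EV])
  also have "\<dots> \<subseteq> [U]\<^bsup>2\<^esup>"
    using E by (intro nsets_mono) (auto simp: nsets_def)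
  finally have "cl E \<subseteq> [U]\<^bsup>2\<^esup>" .
  then have "cl E = [U]\<^bsup>2\<^esup>"
    using U cl_idem[OF EV] k_connected_mono[OF assms(6) subset_cl[OF EV]]
    by (intro closed_highly_connected_complete) auto
  then show ?thesis
    by (simp add: rigid_graph_def)
qed

end
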